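(* Let $E$ be a graph that satisfies the eventually constrained immediate follower set property, and let $(X,\sigma)$ be the associated Deaconu-Renault system. Then $(X,\sigma)$ has the shadowing property.
   Context: $\mathbb N=\{1,2,\ldots\}$. Graphs. A graph is $E=(E^0,E^1,r,s)$ with $E^0,E^1$ countable and $r,s:E^1\to E^0$; all graphs are assumed to have no sinks ($s^{-1}(v)\neq\emptyset$ for all $v\in E^0$). A finite path is a vertex (length $0$) or a sequence of edges $\alpha=\alpha_1\ldots\alpha_k$ with $r(\alpha_i)=s(\alpha_{i+1})$ for $1\le i<k$ (length $|\alpha|=k$); $\mathfrak p$ is the set of finite paths, including vertices, and $\mathfrak p^\infty$ the set of infinite paths $\gamma_1\gamma_2\ldots$ (with $r(\gamma_i)=s(\gamma_{i+1})$). One sets $r(v)=s(v)=v$ for vertices, $r(\alpha)=r(\alpha_{|\alpha|})$, $s(\alpha)=s(\alpha_1)$, $s(\gamma)\gamma=\gamma$, and $\gamma r(\gamma)=\gamma$ for finite $\gamma$. A finite path $\gamma$ is an initial segment of a path $\beta$ if $\beta=\gamma\gamma'$ for some path $\gamma'$ (so $s(\beta)$ is an initial segment of $\beta$). A vertex $v$ is an infinite emitter if $s^{-1}(v)$ is infinite. The associated system. $X=\mathfrak p^\infty\cup X_{fin}$, where $X_{fin}=\{\alpha\in\mathfrak p: r(\alpha)\text{ is an infinite emitter}\}$. The map $\sigma$ has domain $\mathrm{Dom}(\sigma)=\{x\in X:|x|\ge1\}$ and deletes the first edge: $\sigma(\gamma_1\gamma_2\ldots)=\gamma_2\gamma_3\ldots$,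 $\sigma(\gamma_1\ldots\gamma_n)=\gamma_2\ldots\gamma_n$ for $n\ge2$, $\sigma(\gamma_1)=r(\gamma_1)$. Metric. Fix an enumeration $E^1=\{e_1,e_2,\ldots\}$ and an edge ordered enumeration $\mathfrak p=\{p_1,p_2,\ldots\}$, i.e. one such that for every $e_i$ the source of $e_i$ and all paths of length less than $i$ formed by edges $e_k$ with $k<i$ appear before $e_i$. For $x\ne y$ in $X$, $d(x,y)=1/2^i$ where $i$ is the smallest value such that $p_i$ is an initial segment of one of $x,y$ but not of the other; $d(x,x)=0$. Shadowing. A $\delta$-chain is an infinite sequence $(x_i)_{i=1}^\infty$ in $\mathrm{Dom}(\sigma)$ with $d(\sigma(x_i),x_{i+1})<\delta$ for all $i$. A point $x\in X$ $\varepsilon$-shadows $(y_i)_{i=1}^\infty$ if, for all $i$, $\sigma^{i-1}(x)$ is defined and $d(\sigma^{i-1}(x),y_i)<\varepsilon$. $(X,\sigma)$ has the shadowing property if for every $\varepsilon>0$ there is $\delta>0$ such that every $\delta$-chain is $\varepsilon$-shadowed by some $x\in X$. Eventually constrained immediate follower set property. For $e\in E^1$ let $F^1(e)=\{f\in E^1:s(f)=r(e)\}$. $E$ has this property if there is a natural number $k$ such that if $j>k$ and $e_\ell\in F^1(e_j)$, then $\ell\le k$. *)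

theory Defs
  imports Complex_Main "Graph_Theory.Arc_Walk" "HOL-Library.Stream"
    "HOL-Library.Extended_Nat" "HOL-Library.Countable_Set"
begin

section \<open>Graphs and paths\<close>

text \<open>
  A graph \<open>(E\<^sup>0, E\<^sup>1, r, s)\<close> is a digraph \<open>E\<close> with \<open>E\<^sup>0 = verts E\<close>, \<open>E\<^sup>1 = arcs E\<close>,
  \<open>r = head E\<close> and \<open>s = tail E\<close>; parallel arcs and loops are allowed.
\<close>

locale countable_sinkless_digraph = wf_digraph +
  assumes countable_verts: "countable (verts G)"
    and countable_arcs: "countable (arcs G)"
    and no_sinks: "v \<in> verts G \<Longrightarrow> out_arcs G v \<noteq> {}"

definition infinite_emitter :: "('a, 'b) pre_digraph \<Rightarrow> 'a \<Rightarrow> bool" where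
  "infinite_emitter E v \<longleftrightarrow> v \<in> verts E \<and> infinite (out_arcs E v)"

text \<open>
  \<open>FinPath v es\<close> is the finite path with source \<open>v\<close> and list of edges \<open>es\<close>, so that
  \<open>FinPath v []\<close> is the vertex \<open>v\<close> as a path of length 0. For nonempty \<open>es\<close> the source is
  redundant, and membership in \<open>finite_paths\<close> forces it to be the source of the first edge;
  hence every finite path has exactly one representation.
\<close>

datatype ('a, 'b) gpath = FinPath 'a "'b list" | InfPath "'b stream"

definition finite_paths :: "('a, 'b) pre_digraph \<Rightarrow> ('a, 'b) gpath set" where
  "finite_paths E = {FinPath v es |v es. \<exists>w. pre_digraph.awalk E v es w}"

definition infinite_paths :: "('a, 'b) pre_digraph \<Rightarrow> ('a, 'b) gpath set" where
  "infinite_paths E =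
     {InfPath g |g. \<forall>i. g !! i \<in> arcs E \<and> head E (g !! i) = tail E (g !! Suc i)}"

fun path_length :: "('a, 'b) gpath \<Rightarrow> enat" where
  "path_length (FinPath v es) = enat (length es)"
| "path_length (InfPath g) = \<infinity>"

fun path_source :: "('a, 'b) pre_digraph \<Rightarrow> ('a, 'b) gpath \<Rightarrow> 'a" where
  "path_source E (FinPath v es) = v"
| "path_source E (InfPath g) = tail E (shd g)"

text \<open>The range is meaningful for finite paths only.\<close>

fun path_range :: "('a, 'b) pre_digraph \<Rightarrow> ('a, 'b) gpath \<Rightarrow> 'a" where
  "path_range E (FinPath v es) = last (pre_digraph.awalk_verts E v es)"
| "path_range E (InfPath g) = undefined"

text \<open>
  Concatenation \<open>\<gamma> \<gamma>'\<close>, meaningful when \<open>\<gamma>\<close> is finite and its range is the source of \<open>\<gamma>'\<close>.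
\<close>

fun path_append :: "('a, 'b) gpath \<Rightarrow> ('a, 'b) gpath \<Rightarrow> ('a, 'b) gpath" where
  "path_append (FinPath v es) (FinPath w fs) = FinPath v (es @ fs)"
| "path_append (FinPath v es) (InfPath g) = InfPath (es @- g)"
| "path_append (InfPath g) _ = undefined"

definition initial_segment ::
  "('a, 'b) pre_digraph \<Rightarrow> ('a, 'b) gpath \<Rightarrow> ('a, 'b) gpath \<Rightarrow> bool" where
  "initial_segment E p x \<longleftrightarrow> p \<in> finite_paths E \<and>
     (\<exists>q \<in> finite_paths E \<union> infinite_paths E.
        path_range E p = path_source E q \<and> x = path_append p q)"


section \<open>The associated Deaconu-Renault system\<close>

definition boundary_space :: "('a, 'b) pre_digraph \<Rightarrow> ('a, 'b) gpath set" where
  "boundary_space E =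
     infinite_paths E \<union> {x \<in> finite_paths E. infinite_emitter E (path_range E x)}"

definition shift_dom :: "('a, 'b) pre_digraph \<Rightarrow> ('a, 'b) gpath set" where
  "shift_dom E = {x \<in> boundary_space E. path_length x \<ge> 1}"

text \<open>As a total function the shift is meaningful on \<open>shift_dom E\<close> only.\<close>

fun shift_map :: "('a, 'b) pre_digraph \<Rightarrow> ('a, 'b) gpath \<Rightarrow> ('a, 'b) gpath" where
  "shift_map E (FinPath v []) = undefined"
| "shift_map E (FinPath v (e # es)) = FinPath (head E e) es"
| "shift_map E (InfPath g) = InfPath (stl g)"


section \<open>Enumerations and the metric\<close>

text \<open>
  Enumerations are without repetition and start at index 1. A finite set with \<open>n\<close> elements
  is enumerated by the indices \<open>1, \<dots>, n\<close>; the values at other indices are irrelevant.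
\<close>

definition enum_indices :: "'c set \<Rightarrow> nat set" where
  "enum_indices A = (if finite A then {1..card A} else {1..})"

definition enumerates :: "(nat \<Rightarrow> 'c) \<Rightarrow> 'c set \<Rightarrow> bool" where
  "enumerates f A \<longleftrightarrow> bij_betw f (enum_indices A) A"

definition appears_before :: "(nat \<Rightarrow> 'c) \<Rightarrow> 'c set \<Rightarrow> 'c \<Rightarrow> 'c \<Rightarrow> bool" where
  "appears_before f A a b \<longleftrightarrow>
     (\<exists>i \<in> enum_indices A. \<exists>j \<in> enum_indices A. f i = a \<and> f j = b \<and> i < j)"

text \<open>
  Paths \<^emph>\<open>formed by\<close> edges have positive length here: letting every vertex count as a path
  formed by any set of edges would leave no edge ordered enumeration at all when there are
  infinitely many vertices.
\<close>

definition edge_ordered_enumeration ::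
  "('a, 'b) pre_digraph \<Rightarrow> (nat \<Rightarrow> 'b) \<Rightarrow> (nat \<Rightarrow> ('a, 'b) gpath) \<Rightarrow> bool" where
  "edge_ordered_enumeration E e p \<longleftrightarrow> enumerates p (finite_paths E) \<and>
     (\<forall>i \<in> enum_indices (arcs E).
        let ei = FinPath (tail E (e i)) [e i] in
        appears_before p (finite_paths E) (FinPath (tail E (e i)) []) ei \<and>
        (\<forall>v es. FinPath v es \<in> finite_paths E \<and> es \<noteq> [] \<and> length es < i \<and>
            set es \<subseteq> e ` {k \<in> enum_indices (arcs E). k < i} \<longrightarrow>
          appears_before p (finite_paths E) (FinPath v es) ei))"

definition path_dist ::
  "('a, 'b) pre_digraph \<Rightarrow> (nat \<Rightarrow> ('a, 'b) gpath) \<Rightarrow>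
   ('a, 'b) gpath \<Rightarrow> ('a, 'b) gpath \<Rightarrow> real" where
  "path_dist E p x y =
     (if x = y then 0
      else 1 / 2 ^ (LEAST i. i \<in> enum_indices (finite_paths E) \<and>
                      initial_segment E (p i) x \<noteq> initial_segment E (p i) y))"


section \<open>Shadowing\<close>

text \<open>
  Here \<open>f\<close> is a partial map with domain \<open>D\<close>, so \<open>f\<^sup>i x\<close> is defined if and only if
  \<open>f\<^sup>j x \<in> D\<close> for all \<open>j < i\<close>. Sequences are indexed from 0 instead of 1.
\<close>

definition delta_chain ::
  "'x set \<Rightarrow> ('x \<Rightarrow> 'x) \<Rightarrow> ('x \<Rightarrow> 'x \<Rightarrow> real) \<Rightarrow> real \<Rightarrow> (nat \<Rightarrow> 'x) \<Rightarrow> bool" where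
  "delta_chain D f d \<delta> xs \<longleftrightarrow> (\<forall>i. xs i \<in> D \<and> d (f (xs i)) (xs (Suc i)) < \<delta>)"

definition iterate_defined :: "'x set \<Rightarrow> ('x \<Rightarrow> 'x) \<Rightarrow> nat \<Rightarrow> 'x \<Rightarrow> bool" where
  "iterate_defined D f i x \<longleftrightarrow> (\<forall>j<i. (f ^^ j) x \<in> D)"

definition shadows ::
  "'x set \<Rightarrow> ('x \<Rightarrow> 'x) \<Rightarrow> ('x \<Rightarrow> 'x \<Rightarrow> real) \<Rightarrow> real \<Rightarrow> 'x \<Rightarrow> (nat \<Rightarrow> 'x) \<Rightarrow> bool" where
  "shadows D f d \<epsilon> x ys \<longleftrightarrow>
     (\<forall>i. iterate_defined D f i x \<and> d ((f ^^ i) x) (ys i) < \<epsilon>)"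

definition shadowing_property ::
  "'x set \<Rightarrow> 'x set \<Rightarrow> ('x \<Rightarrow> 'x) \<Rightarrow> ('x \<Rightarrow> 'x \<Rightarrow> real) \<Rightarrow> bool" where
  "shadowing_property X D f d \<longleftrightarrow>
     (\<forall>\<epsilon>>0. \<exists>\<delta>>0. \<forall>xs. delta_chain D f d \<delta> xs \<longrightarrow> (\<exists>x\<in>X. shadows D f d \<epsilon> x xs))"


section \<open>Eventually constrained immediate follower sets\<close>

definition immediate_followers :: "('a, 'b) pre_digraph \<Rightarrow> 'b \<Rightarrow> 'b set" where
  "immediate_followers E a = {b \<in> arcs E. tail E b = head E a}"

definition eventually_constrained_followers ::
  "('a, 'b) pre_digraph \<Rightarrow> (nat \<Rightarrow> 'b) \<Rightarrow> bool" where
  "eventually_constrained_followers E e \<longleftrightarrow>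
     (\<exists>k\<ge>1. \<forall>j \<in> enum_indices (arcs E). \<forall>l \<in> enum_indices (arcs E).
        j > k \<and> e l \<in> immediate_followers E (e j) \<longrightarrow> l \<le> k)"

end

theory Submission
  imports Defs
begin

text \<open>
  Let \<open>k\<close> be the constant of the follower condition. If an edge \<open>e\<^sub>j\<close> has \<open>j > k\<close>, its range
  emits only edges among \<open>e\<^sub>1, \<dots>, e\<^sub>k\<close>; in particular it is not an infinite emitter. Hence,
  for \<open>\<delta>\<close> so small that \<open>\<delta>\<close>-close points have the same initial segments among the edges
  \<open>e\<^sub>1, \<dots>, e\<^sub>k\<close> and their ranges, the first edges of the points of a \<open>\<delta>\<close>-chain are
  composable: the next point is pinned down by the range of the current first edge if that edge
  is among \<open>e\<^sub>1, \<dots>, e\<^sub>k\<close>, and by the second edge otherwise. The infinite path formed by these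
  first edges shadows the chain as soon as \<open>\<delta>\<close>-close points also have the same initial segments
  among the terminal segments of the finitely many paths that control \<open>\<epsilon>\<close>-closeness.
\<close>

section \<open>Auxiliary notions for paths and streams\<close>

fun first_edge :: "('a, 'b) gpath \<Rightarrow> 'b" where
  "first_edge (FinPath v es) = hd es"
| "first_edge (InfPath g) = shd g"

text \<open>Testing a path at later and later points of a chain means testing what remains after its
  front edges are removed. All these remainders, down to the range vertex, must therefore be
  controlled.\<close>

fun terminal_segments :: "('a, 'b) pre_digraph \<Rightarrow> ('a, 'b) gpath \<Rightarrow> ('a, 'b) gpath set" where
  "terminal_segments E (FinPath v []) = {FinPath v []}"
| "terminal_segments E (FinPath v (c # cs)) =
     insert (FinPath v (c # cs)) (terminal_segments E (FinPath (head E c) cs))"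
| "terminal_segments E (InfPath g) = {}"

lemma finite_terminal_segments: "finite (terminal_segments E q)"
  by (induction E q rule: terminal_segments.induct) auto

lemma shift_map_funpow_InfPath: "(shift_map E ^^ i) (InfPath g) = InfPath (sdrop i g)"
  by (induction i arbitrary: g) (auto simp: funpow_swap1)

lemma stream_eq_if_stake_eq:
  assumes "\<And>n. stake n g = stake n h"
  shows "g = h"
proof -
  have "g !! n = h !! n" for n
    using assms[of "Suc n"] stake_nth[of n "Suc n"] by (metis lessI)
  then have "(!!) g = (!!) h"
    by blast
  then show ?thesis
    using stream_smap_nats by metis
qed

context wf_digraph
begin

section \<open>Points of the space and the domain of the shift\<close>

lemma FinPath_Nil_in_finite_paths: "FinPath v [] \<in> finite_paths G \<longleftrightarrow> v \<in> verts G"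
  by (auto simp: finite_paths_def awalk_Nil_iff)

lemma FinPath_Cons_in_finite_paths:
  "FinPath v (c # cs) \<in> finite_paths G \<longleftrightarrow>
     c \<in> arcs G \<and> v = tail G c \<and> FinPath (head G c) cs \<in> finite_paths G"
  by (auto simp: finite_paths_def awalk_Cons_iff)

lemma InfPath_in_infinite_paths:
  "InfPath g \<in> infinite_paths G \<longleftrightarrow>
     (\<forall>i. g !! i \<in> arcs G \<and> head G (g !! i) = tail G (g !! Suc i))"
  by (auto simp: infinite_paths_def)

lemma path_range_Cons:
  "path_range G (FinPath v (c # cs)) = path_range G (FinPath (head G c) cs)"
  by (cases cs) auto

lemma boundary_space_subset: "boundary_space G \<subseteq> finite_paths G \<union> infinite_paths G"
  by (auto simp: boundary_space_def)

lemma InfPath_in_shift_dom: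
  assumes "InfPath g \<in> infinite_paths G"
  shows "InfPath g \<in> shift_dom G"
  using assms by (auto simp: shift_dom_def boundary_space_def)

lemma shift_dom_cases [consumes 1, case_names fin inf]:
  assumes "x \<in> shift_dom G"
  obtains c cs where "x = FinPath (tail G c) (c # cs)" "c \<in> arcs G"
      "FinPath (head G c) cs \<in> finite_paths G"
      "infinite_emitter G (path_range G (FinPath (head G c) cs))"
  | g where "x = InfPath g" "InfPath g \<in> infinite_paths G"
proof (cases x)
  case (FinPath v es)
  moreover obtain c cs where "es = c # cs"
    using assms FinPath by (cases es) (auto simp: shift_dom_def zero_enat_def one_enat_def)
  ultimately show ?thesis
    using assms that(1)[of c cs] path_range_Cons[of v c cs]
    by (auto simp: shift_dom_def boundary_space_def infinite_paths_def
        FinPath_Cons_in_finite_paths)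
next
  case (InfPath g)
  then show ?thesis
    using assms that(2) by (auto simp: shift_dom_def boundary_space_def finite_paths_def)
qed

lemma stl_in_infinite_paths:
  assumes "InfPath g \<in> infinite_paths G"
  shows "InfPath (stl g) \<in> infinite_paths G"
  using assms unfolding InfPath_in_infinite_paths by (metis snth.simps(2))

lemma shd_in_arcs:
  assumes "InfPath g \<in> infinite_paths G"
  shows "shd g \<in> arcs G" "head G (shd g) = tail G (shd (stl g))"
  using assms unfolding InfPath_in_infinite_paths by (metis snth.simps)+

lemma shift_dom_first_edge:
  assumes "x \<in> shift_dom G"
  shows "first_edge x \<in> arcs G"
    and "path_source G x = tail G (first_edge x)"
    and "path_source G (shift_map G x) = head G (first_edge x)"
    and "shift_map G x \<in> boundary_space G"
  using assms
  by (cases rule: shift_dom_cases;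
      auto simp: boundary_space_def shd_in_arcs stl_in_infinite_paths)+

text \<open>Such a point is a bare vertex, and a vertex belongs to the space only as an infinite
  emitter. The contrapositive guarantees that certain shifted points still have a first
  edge.\<close>

lemma boundary_space_not_shift_dom:
  assumes "x \<in> boundary_space G" "x \<notin> shift_dom G"
  shows "infinite_emitter G (path_source G x)"
proof (cases x)
  case (FinPath v es)
  then have "es = []"
    using assms by (cases es) (auto simp: shift_dom_def zero_enat_def one_enat_def)
  then show ?thesis
    using assms FinPath by (auto simp: boundary_space_def infinite_paths_def)
qed (use assms in \<open>auto simp: shift_dom_def\<close>)

section \<open>Initial segments and the points they determine\<close>

lemma initial_segment_Nil:
  assumes "x \<in> boundary_space G"
  shows "initial_segment G (FinPath v []) x \<longleftrightarrow> v \<in> verts G \<and> path_source G x = v"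
proof -
  \<comment> \<open>The complement of an initial vertex can only be the point itself.\<close>
  have "path_source G q = v \<and> x = path_append (FinPath v []) q \<longleftrightarrow>
      q = x \<and> path_source G x = v" for q
    by (cases q) auto
  then show ?thesis
    using assms boundary_space_subset
    by (auto simp: initial_segment_def FinPath_Nil_in_finite_paths)
qed

lemma initial_segment_Cons:
  assumes "x \<in> shift_dom G"
  shows "initial_segment G (FinPath v (c # cs)) x \<longleftrightarrow>
     v = tail G c \<and> first_edge x = c \<and>
     initial_segment G (FinPath (head G c) cs) (shift_map G x)"
proof -
  \<comment> \<open>The same complement \<open>q\<close> serves both sides. Appending an infinite
    path forgets \<open>v\<close>, so \<open>v = tail G c\<close> is carried along
    explicitly.\<close>
  have "c \<in> arcs G \<and> v = tail G c \<and> x = path_append (FinPath v (c # cs)) q \<longleftrightarrow>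
      v = tail G c \<and> first_edge x = c \<and> shift_map G x = path_append (FinPath (head G c) cs) q" for q
    using assms
  proof (cases rule: shift_dom_cases)
    case (fin d ds)
    then show ?thesis by (cases q) auto
  next
    case (inf g)
    then show ?thesis
      using shd_in_arcs(1)[OF inf(2)] by (cases q; cases g) auto
  qed
  then show ?thesis
    unfolding initial_segment_def FinPath_Cons_in_finite_paths path_range_Cons by blast
qed

lemma initial_segment_stake:
  assumes "InfPath g \<in> infinite_paths G"
  shows "initial_segment G (FinPath (tail G (shd g)) (stake n g)) (InfPath g)"
  using assms
proof (induction n arbitrary: g)
  case 0
  then show ?case
    using InfPath_in_shift_dom shd_in_arcs(1)
    by (auto simp: initial_segment_Nil shift_dom_def)
next
  case (Suc n)
  then show ?case
    using Suc.IH[OF stl_in_infinite_paths] shd_in_arcs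
    by (auto simp: initial_segment_Cons InfPath_in_shift_dom)
qed

text \<open>An infinite path is recovered from its finite prefixes: a finite \<open>x\<close> is too
  short to have them all, and an infinite one must coincide with \<open>g\<close>. This makes the
  least index in \<open>path_dist\<close> meaningful.\<close>

lemma ex_initial_segment_differs:
  assumes "InfPath g \<in> infinite_paths G" "x \<noteq> InfPath g"
  shows "\<exists>q \<in> finite_paths G. initial_segment G q (InfPath g) \<noteq> initial_segment G q x"
proof (rule ccontr)
  assume "\<not> ?thesis"
  then have *: "initial_segment G (FinPath (tail G (shd g)) (stake n g)) x" for n
    using initial_segment_stake[OF assms(1), of n] initial_segment_def by metis
  show False
  proof (cases x)
    case (FinPath v es)
    obtain q where "x = path_append (FinPath (tail G (shd g)) (stake (Suc (length es)) g)) q"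
      using *[of "Suc (length es)"] by (auto simp: initial_segment_def simp del: stake.simps)
    then show False
      using FinPath by (cases q) (auto simp del: stake.simps dest: arg_cong[of _ _ length])
  next
    case (InfPath h)
    have "stake n g = stake n h" for n
    proof -
      obtain q where "x = path_append (FinPath (tail G (shd g)) (stake n g)) q"
        using *[of n] by (auto simp: initial_segment_def)
      then show ?thesis
        using InfPath by (cases q) (auto simp: stake_shift)
    qed
    then show False
      using stream_eq_if_stake_eq assms(2) InfPath by blast
  qed
qed

section \<open>First edges along a chain\<close>

lemma first_edges_composable:
  assumes "enumerates e (arcs G)"
    and follow: "\<And>j l. j \<in> enum_indices (arcs G) \<Longrightarrow> l \<in> enum_indices (arcs G) \<Longrightarrow>
      k < j \<Longrightarrow> e l \<in> immediate_followers G (e j) \<Longrightarrow> l \<le> k"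
    and dom: "x \<in> shift_dom G" "y \<in> shift_dom G"
    and ranges: "\<And>j. j \<le> k \<Longrightarrow> initial_segment G (FinPath (head G (e j)) []) (shift_map G x) =
      initial_segment G (FinPath (head G (e j)) []) y"
    and edges: "\<And>j. j \<le> k \<Longrightarrow> initial_segment G (FinPath (tail G (e j)) [e j]) (shift_map G x) =
      initial_segment G (FinPath (tail G (e j)) [e j]) y"
  shows "head G (first_edge x) = tail G (first_edge y)"
proof -
  have enum: "arcs G = e ` enum_indices (arcs G)"
    using assms(1) by (auto simp: enumerates_def bij_betw_def)
  note x = shift_dom_first_edge[OF dom(1)] and y = shift_dom_first_edge[OF dom(2)]
  obtain j where j: "j \<in> enum_indices (arcs G)" "first_edge x = e j"
    using x(1) enum by blast
  have ybd: "y \<in> boundary_space G"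
    using dom(2) by (auto simp: shift_dom_def)
  show ?thesis
  proof (cases "j \<le> k")
    case True
    \<comment> \<open>The range of \<open>e j\<close> is one of the tested vertices, so
      \<open>y\<close> has the same source as the shifted \<open>x\<close>.\<close>
    then show ?thesis
      using ranges[OF True] initial_segment_Nil[OF x(4)] initial_segment_Nil[OF ybd] x(1,3) y(2) j(2)
      by simp
  next
    case False
    have small: "b \<in> e ` {..k}" if b: "b \<in> arcs G" "tail G b = head G (e j)" for b
    proof -
      obtain l where "l \<in> enum_indices (arcs G)" "b = e l"
        using b(1) enum by blast
      then show ?thesis
        using follow[OF j(1)] False b by (auto simp: immediate_followers_def)
    qed
    then have "out_arcs G (head G (e j)) \<subseteq> e ` {..k}"
      by auto
    then have "\<not> infinite_emitter G (head G (e j))"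
      using finite_subset by (auto simp: infinite_emitter_def)
    \<comment> \<open>The shifted \<open>x\<close> starts at the range of \<open>e j\<close>. As
      this is no infinite emitter, the point cannot be a bare vertex.\<close>
    then have sx: "shift_map G x \<in> shift_dom G"
      using boundary_space_not_shift_dom x j(2) by metis
    note b = shift_dom_first_edge[OF sx]
    obtain l where l: "l \<le> k" "first_edge (shift_map G x) = e l"
      using small[OF b(1)] b(2) x(3) j(2) by auto
    \<comment> \<open>The second edge of \<open>x\<close> has index at most \<open>k\<close>, so it
      is a tested one-edge path and passes to \<open>y\<close> as its first edge.\<close>
    have "initial_segment G (FinPath (tail G (e l)) [e l]) (shift_map G x)"
      using b l by (auto simp: initial_segment_Cons[OF sx] initial_segment_Nil)
    then have "first_edge y = e l"
      using edges[OF l(1)] initial_segment_Cons[OF dom(2)] by blast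
    then show ?thesis
      using b(2) l(2) x(3) by simp
  qed
qed

text \<open>Induction on the edges of \<open>q\<close>: both points have the same first edge, and
  the rest of \<open>q\<close> is compared at index \<open>Suc i\<close>. A chain follows the shift
  only approximately, so each round needs agreement of \<open>xs (Suc i)\<close> with the shifted
  \<open>xs i\<close> on that rest, a terminal segment of \<open>q\<close>.\<close>

lemma initial_segment_first_edges:
  assumes dom: "\<And>i. xs i \<in> shift_dom G"
    and g: "InfPath g \<in> infinite_paths G" "\<And>i. g !! i = first_edge (xs i)"
    and "\<And>i q'. q' \<in> terminal_segments G q \<Longrightarrow>
      initial_segment G q' (shift_map G (xs i)) = initial_segment G q' (xs (Suc i))"
  shows "initial_segment G q (InfPath (sdrop i g)) = initial_segment G q (xs i)"
  using assms(4)
proof (cases q)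
  case (FinPath v es)
  have sd: "InfPath (sdrop i g) \<in> shift_dom G" for i
    using g(1) by (intro InfPath_in_shift_dom) (auto simp: InfPath_in_infinite_paths sdrop_snth)
  have fe: "first_edge (InfPath (sdrop i g)) = first_edge (xs i)" for i
    using g(2)[of i] by simp
  show ?thesis
    using assms(4) unfolding FinPath
  proof (induction es arbitrary: v i)
    case Nil
    show ?case
      using shift_dom_first_edge(2)[OF sd[of i]] shift_dom_first_edge(2)[OF dom[of i]] fe[of i]
        sd[of i] dom[of i]
      by (simp add: initial_segment_Nil shift_dom_def)
  next
    case (Cons c cs)
    have "initial_segment G (FinPath (head G c) cs) (InfPath (sdrop (Suc i) g)) =
        initial_segment G (FinPath (head G c) cs) (xs (Suc i))"
      using Cons.prems by (intro Cons.IH) simp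
    also have "\<dots> = initial_segment G (FinPath (head G c) cs) (shift_map G (xs i))"
      using Cons.prems[of "FinPath (head G c) cs" i] by (cases cs) auto
    finally show ?case
      using fe[of i] by (auto simp: initial_segment_Cons sd dom)
  qed
qed (auto simp: initial_segment_def finite_paths_def)

end

section \<open>Closeness and agreement on finitely many paths\<close>

lemma path_dist_less_imp_initial_segment_eq:
  assumes "enumerates p (finite_paths E)" "finite Q"
  shows "\<exists>\<delta>>0. \<forall>x y. path_dist E p x y < \<delta> \<longrightarrow>
    (\<forall>q\<in>Q. initial_segment E q x = initial_segment E q y)"
proof -
  \<comment> \<open>Elements of \<open>Q\<close> outside \<open>finite_paths E\<close> are initial
    segments of nothing, so only finitely many indices matter.\<close>
  obtain J where J: "J \<subseteq> enum_indices (finite_paths E)" "finite J" "Q \<inter> finite_paths E = p ` J"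
    using assms finite_subset_image[of "Q \<inter> finite_paths E" p "enum_indices (finite_paths E)"]
    by (auto simp: enumerates_def bij_betw_def)
  obtain M where M: "\<forall>i\<in>J. i \<le> M"
    using J(2) finite_nat_set_iff_bounded_le[of J] by auto
  have "initial_segment E q x = initial_segment E q y"
    if d: "path_dist E p x y < 1 / 2 ^ M" and q: "q \<in> Q" for x y q
  proof (rule ccontr)
    assume ne: "initial_segment E q x \<noteq> initial_segment E q y"
    then have "q \<in> finite_paths E"
      by (auto simp: initial_segment_def)
    then obtain i where i: "i \<in> J" "q = p i"
      using J(3) q by blast
    \<comment> \<open>A distinguishing path with index at most \<open>M\<close> would force the
      distance up to \<open>1 / 2 ^ M\<close>.\<close>
    have "(LEAST i. i \<in> enum_indices (finite_paths E) \<and>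
        initial_segment E (p i) x \<noteq> initial_segment E (p i) y) \<le> i"
      using i ne J(1) by (intro Least_le) auto
    also have "\<dots> \<le> M"
      using M i(1) by simp
    finally have "1 / 2 ^ M \<le> path_dist E p x y"
      using ne by (auto simp: path_dist_def intro!: divide_left_mono)
    then show False
      using d by simp
  qed
  then show ?thesis
    by (intro exI[of _ "1 / 2 ^ M"]) auto
qed

text \<open>Agreement on the paths with index up to \<open>N\<close> pushes the least distinguishing
  index beyond \<open>N\<close>. That some path distinguishes the points is assumed because the
  least element of an empty set of indices is unspecified.\<close>

lemma initial_segment_eq_imp_path_dist_less:
  assumes "enumerates p (finite_paths E)" "\<epsilon> > 0"
  shows "\<exists>F. finite F \<and> (\<forall>x y.
    (\<exists>q\<in>finite_paths E. initial_segment E q x \<noteq> initial_segment E q y) \<and>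
    (\<forall>q\<in>F. initial_segment E q x = initial_segment E q y) \<longrightarrow> path_dist E p x y < \<epsilon>)"
proof -
  obtain N where N: "(1 / 2) ^ N < \<epsilon>"
    using real_arch_pow_inv[of \<epsilon> "1 / 2"] assms(2) by auto
  have "path_dist E p x y < \<epsilon>"
    if ex: "\<exists>q\<in>finite_paths E. initial_segment E q x \<noteq> initial_segment E q y"
      and eq: "\<forall>q\<in>p ` {..N}. initial_segment E q x = initial_segment E q y" for x y
  proof -
    define P where "P = (\<lambda>i. i \<in> enum_indices (finite_paths E) \<and>
        initial_segment E (p i) x \<noteq> initial_segment E (p i) y)"
    obtain q where q: "q \<in> finite_paths E" "initial_segment E q x \<noteq> initial_segment E q y"
      using ex ..
    moreover obtain i where "i \<in> enum_indices (finite_paths E)" "q = p i"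
      using q(1) assms(1) by (auto simp: enumerates_def bij_betw_def)
    ultimately have "P i"
      by (simp add: P_def)
    then have "P (LEAST i. P i)"
      by (rule LeastI)
    moreover have "\<not> P i" if "i \<le> N" for i
      using eq that by (auto simp: P_def)
    ultimately have "N \<le> (LEAST i. P i)"
      using nle_le by blast
    then have "path_dist E p x y \<le> (1 / 2) ^ N"
      unfolding path_dist_def P_def[symmetric]
      by (simp add: power_one_over divide_left_mono)
    then show ?thesis
      using N by simp
  qed
  then show ?thesis
    by (intro exI[of _ "p ` {..N}"]) auto
qed

section \<open>The shadowing infinite path\<close>

theorem proposition5p10:
  fixes E :: "('a, 'b) pre_digraph"
    and e :: "nat \<Rightarrow> 'b"
    and p :: "nat \<Rightarrow> ('a, 'b) gpath"
  assumes "countable_sinkless_digraph E"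
    and "enumerates e (arcs E)"
    and "edge_ordered_enumeration E e p"
    and "eventually_constrained_followers E e"
  shows "shadowing_property (boundary_space E) (shift_dom E) (shift_map E) (path_dist E p)"
  unfolding shadowing_property_def
proof (intro allI impI)
  fix \<epsilon> :: real
  assume "\<epsilon> > 0"
  interpret wf_digraph E
    using assms(1) by (rule countable_sinkless_digraph.axioms)
  have p: "enumerates p (finite_paths E)"
    using assms(3) by (simp add: edge_ordered_enumeration_def)
  obtain k where k: "\<And>j l. j \<in> enum_indices (arcs E) \<Longrightarrow> l \<in> enum_indices (arcs E) \<Longrightarrow>
      k < j \<Longrightarrow> e l \<in> immediate_followers E (e j) \<Longrightarrow> l \<le> k"
    using assms(4) by (auto simp: eventually_constrained_followers_def)
  obtain F where F: "finite F" "\<And>x y.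
      \<exists>q\<in>finite_paths E. initial_segment E q x \<noteq> initial_segment E q y \<Longrightarrow>
      \<forall>q\<in>F. initial_segment E q x = initial_segment E q y \<Longrightarrow> path_dist E p x y < \<epsilon>"
    using initial_segment_eq_imp_path_dist_less[OF p \<open>\<epsilon> > 0\<close>] by blast
  \<comment> \<open>The terminal segments yield the shadowing estimate; the vertices and one-edge
    paths make first edges composable. Index 0 lies outside the enumeration, but only adds paths to
    agree on.\<close>
  define Q where "Q = (\<Union>q\<in>F. terminal_segments E q) \<union>
    (\<lambda>j. FinPath (head E (e j)) []) ` {..k} \<union> (\<lambda>j. FinPath (tail E (e j)) [e j]) ` {..k}"
  have Q: "finite Q"
    using F(1) by (simp add: Q_def finite_terminal_segments)
  obtain \<delta> where "\<delta> > 0" and \<delta>: "\<forall>x y. path_dist E p x y < \<delta> \<longrightarrow>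
      (\<forall>q\<in>Q. initial_segment E q x = initial_segment E q y)"
    using path_dist_less_imp_initial_segment_eq[OF p Q] by (elim exE conjE)
  have "\<exists>x\<in>boundary_space E. shadows (shift_dom E) (shift_map E) (path_dist E p) \<epsilon> x xs"
    if chain: "delta_chain (shift_dom E) (shift_map E) (path_dist E p) \<delta> xs" for xs
  proof -
    have dom: "xs i \<in> shift_dom E" for i
      using chain by (simp add: delta_chain_def)
    have agree: "initial_segment E q (shift_map E (xs i)) = initial_segment E q (xs (Suc i))"
      if "q \<in> Q" for q i
      using chain that \<delta> by (simp add: delta_chain_def)
    define g where "g = smap (\<lambda>i. first_edge (xs i)) nats"
    have g: "g !! i = first_edge (xs i)" for i
      by (simp add: g_def)
    have "head E (first_edge (xs i)) = tail E (first_edge (xs (Suc i)))" for i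
      by (rule first_edges_composable[OF assms(2) k dom dom]) (auto intro!: agree simp: Q_def)
    then have inf: "InfPath g \<in> infinite_paths E"
      by (simp add: InfPath_in_infinite_paths g shift_dom_first_edge(1)[OF dom] del: snth.simps)
    have sd: "InfPath (sdrop i g) \<in> infinite_paths E" for i
      using inf by (auto simp: InfPath_in_infinite_paths sdrop_snth)
    have "path_dist E p (InfPath (sdrop i g)) (xs i) < \<epsilon>" for i
    \<comment> \<open>Equal points are treated apart, since no path distinguishes them.\<close>
    proof (cases "xs i = InfPath (sdrop i g)")
      case True
      then show ?thesis
        using \<open>\<epsilon> > 0\<close> by (simp add: path_dist_def)
    next
      case False
      have "\<forall>q\<in>F. initial_segment E q (InfPath (sdrop i g)) = initial_segment E q (xs i)"
        by (intro ballI initial_segment_first_edges[OF dom inf g] agree) (auto simp: Q_def)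
      then show ?thesis
        using F(2) ex_initial_segment_differs[OF sd False] by blast
    qed
    \<comment> \<open>Every iterate of an infinite path is again infinite, hence in the domain of
      the shift.\<close>
    then have "shadows (shift_dom E) (shift_map E) (path_dist E p) \<epsilon> (InfPath g) xs"
      using InfPath_in_shift_dom[OF sd]
      by (simp add: shadows_def iterate_defined_def shift_map_funpow_InfPath)
    then show ?thesis
      using inf by (auto simp: boundary_space_def)
  qed
  then show "\<exists>\<delta>>0. \<forall>xs. delta_chain (shift_dom E) (shift_map E) (path_dist E p) \<delta> xs \<longrightarrow>
      (\<exists>x\<in>boundary_space E. shadows (shift_dom E) (shift_map E) (path_dist E p) \<epsilon> x xs)"
    using \<open>\<delta> > 0\<close> by (intro exI[of _ \<delta>]) simp
qed

end
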